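(* Let $d\ge 2$, let $\hat K\subset\mathbb{R}^{d-1}$ be the reference simplex, and let $K\subset\mathbb{R}^d$ be any surface simplex, i.e. a $(d-1)$-dimensional simplex in $\mathbb{R}^d$. Let $F_K:\hat K\to K$ be the affine mapping between them and $F_K'\in\mathbb{R}^{d\times(d-1)}$ its Jacobian matrix. Then $$\frac{|K|}{|\hat K|}=\det\left((F_K')^TF_K'\right)^{1/2},$$ where $|K|$ and $|\hat K|$ denote the areas ($(d-1)$-dimensional volumes) of $K$ and $\hat K$, respectively.
   Context: The reference element $\hat K$ is a fixed nondegenerate equilateral $(d-1)$-simplex in $\mathbb{R}^{d-1}$ with vertices $\xi_1,\dots,\xi_d$. If $x_1^K,\dots,x_d^K\in\mathbb{R}^d$ are the vertices of $K$, then $F_K$ is the affine map with $F_K(\xi_j)=x_j^K$ for $j=1,\dots,d$. *)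

theory Defs
  imports "HOL-Analysis.Analysis"
begin

definition affine_map :: "('a::real_vector \<Rightarrow> 'b::real_vector) \<Rightarrow> bool" where
  "affine_map f \<longleftrightarrow> (\<exists>L b. linear L \<and> f = (\<lambda>x. L x + b))"

(* The n-dimensional volume, n = CARD('n), of a set S lying in an n-dimensional affine
   subspace of a Euclidean space: Lebesgue measure after an isometric identification of
   such a subspace with real^'n.  The value does not depend on the identification, since
   Lebesgue measure is invariant under isometries of real^'n, and a set contained in two
   different n-dimensional affine subspaces has measure 0 in both.  If S lies in no
   n-dimensional affine subspace, the value is unspecified. *)
definition flat_volume :: "'n::finite itself \<Rightarrow> 'a::euclidean_space set \<Rightarrow> real" where
  "flat_volume _ S = (THE v. \<exists>\<phi> :: real^'n \<Rightarrow> 'a.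
      (\<forall>x y. dist (\<phi> x) (\<phi> y) = dist x y) \<and> S \<subseteq> range \<phi> \<and> v = measure lebesgue (\<phi> -` S))"

(* p 1, ..., p d are the pairwise distinct vertices of a (d - 1)-dimensional simplex S *)
definition simplex_with_vertices ::
    "nat \<Rightarrow> (nat \<Rightarrow> 'a::euclidean_space) \<Rightarrow> 'a set \<Rightarrow> bool" where
  "simplex_with_vertices d p S \<longleftrightarrow>
     (int d - 1) simplex S \<and> bij_betw p {1..d} {v. v extreme_point_of S}"

definition equilateral :: "nat \<Rightarrow> (nat \<Rightarrow> 'a::metric_space) \<Rightarrow> bool" where
  "equilateral d p \<longleftrightarrow>
     (\<exists>h>0. \<forall>i\<in>{1..d}. \<forall>j\<in>{1..d}. i \<noteq> j \<longrightarrow> dist (p i) (p j) = h)"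

end

theory Submission
  imports Defs
begin

text \<open>
  Write \<open>F w = L w + b\<close> with \<open>A\<close> the matrix of \<open>L\<close>, which is also the Jacobian of \<open>F\<close> at every
  point. The volume of \<open>K = F ` Khat\<close> is read off in a chart: an isometry \<open>\<phi>\<close> of \<open>real^'n\<close>
  whose range contains \<open>K\<close>. Such charts exist because \<open>K\<close> spans an \<open>n\<close>-dimensional affine
  subspace (\<open>ex_isometry_covering\<close>), and each of them is affine,
  \<open>\<phi> z = Q z + c\<close> with \<open>Q\<close> preserving the inner product.

  Since \<open>Khat\<close> affinely spans its space, the range of \<open>\<phi>\<close> contains the whole range of \<open>F\<close> and
  not just \<open>K\<close>. Hence \<open>L\<close> factors as \<open>Q \<circ> G\<close> with \<open>G\<close> a linear endomorphism, and \<open>\<phi> -` K\<close> is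
  a translate of \<open>G ` Khat\<close>, which has measure \<open>\<bar>det G\<bar>\<close> times that of \<open>Khat\<close>
  (\<open>measure_linear_image_unordered\<close>). Because \<open>Q\<close> preserves inner products, \<open>L\<close> and \<open>G\<close> have the same Gram matrix, so
  \<open>(det G)\<^sup>2 = det (transpose A ** A)\<close> (\<open>det_Gram_isometry_factor\<close>). This
  value is the same for all charts, which is what the definite description in the definition of the volume requires. Finally, \<open>Khat\<close> is
  full-dimensional, so its measure is positive and may be divided by.
\<close>

section \<open>Isometric charts of affine subspaces\<close>

text \<open>
  Preserving distances to \<open>0\<close> means preserving norms, so polarization gives preservation of inner
  products; then the defect \<open>f (x + y) - f x - f y\<close> has the same norm as \<open>(x + y) - x - y = 0\<close>,
  and similarly for scaling.
\<close>
lemma isometry_fixing_0_imp_linear: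
  fixes f :: "'a::real_inner \<Rightarrow> 'b::real_inner"
  assumes "f 0 = 0" and iso: "\<And>x y. dist (f x) (f y) = dist x y"
  shows "linear f" and "f x \<bullet> f y = x \<bullet> y"
proof -
  have nrm: "norm (f x) = norm x" for x
    using iso[of x 0] assms(1) by simp
  have inn: "f x \<bullet> f y = x \<bullet> y" for x y
    using iso[of x y] by (simp add: dist_norm dot_norm_neg nrm)
  then show "f x \<bullet> f y = x \<bullet> y" .
  show "linear f"
  proof
    fix x y
    have "(f (x + y) - f x - f y) \<bullet> (f (x + y) - f x - f y) = 0"
      by (simp add: inn inner_diff_left inner_diff_right inner_add_left inner_add_right
          inner_commute)
    then have "f (x + y) - f x - f y = 0"
      by (simp only: inner_eq_zero_iff)
    then show "f (x + y) = f x + f y" by (simp add: algebra_simps)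
  next
    fix c x
    have "(f (c *\<^sub>R x) - c *\<^sub>R f x) \<bullet> (f (c *\<^sub>R x) - c *\<^sub>R f x) = 0"
      by (simp add: inn inner_diff_left inner_diff_right)
    then show "f (c *\<^sub>R x) = c *\<^sub>R f x" by simp
  qed
qed

lemma isometry_affine_form:
  fixes \<phi> :: "'a::real_inner \<Rightarrow> 'b::real_inner"
  assumes iso: "\<And>x y. dist (\<phi> x) (\<phi> y) = dist x y"
  obtains Q c where "linear Q" and "\<And>x y. Q x \<bullet> Q y = x \<bullet> y" and "\<phi> = (\<lambda>x. Q x + c)"
proof -
  define Q where "Q x = \<phi> x - \<phi> 0" for x
  have "Q 0 = 0" and "\<And>x y. dist (Q x) (Q y) = dist x y"
    by (simp_all add: Q_def iso[unfolded dist_norm] dist_norm)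
  moreover have "\<phi> = (\<lambda>x. Q x + \<phi> 0)"
    by (simp add: Q_def)
  ultimately show thesis
    using isometry_fixing_0_imp_linear[of Q] that by blast
qed

text \<open>
  The differences of points of \<open>S\<close> span a subspace of dimension \<open>CARD('n)\<close>, and subspaces of equal
  dimension are linearly isometric.
\<close>
lemma ex_isometry_covering:
  fixes S :: "'a::euclidean_space set"
  assumes "aff_dim S = int CARD('n)"
  shows "\<exists>\<phi> :: real^'n::finite \<Rightarrow> 'a. (\<forall>x y. dist (\<phi> x) (\<phi> y) = dist x y) \<and> S \<subseteq> range \<phi>"
proof -
  from assms have "S \<noteq> {}" by auto
  then obtain a where a: "a \<in> S" by blast
  define T where "T = span ((+) (- a) ` S)"
  have "int (dim T) = aff_dim S"
    using aff_dim_eq_dim[of a S] a by (simp add: T_def hull_inc dim_span)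
  then have "dim (UNIV :: (real^'n) set) = dim T"
    using assms by (simp add: dim_UNIV)
  then obtain Q :: "real^'n \<Rightarrow> 'a"
    where Q: "linear Q" "Q ` UNIV = T" "\<And>x. norm (Q x) = norm x"
    using isometry_subspaces[of "UNIV :: (real^'n) set" T]
    by (auto simp: T_def subspace_span)
  have "dist (a + Q x) (a + Q y) = dist x y" for x y
    by (simp add: dist_norm Q(3) flip: linear_diff[OF Q(1)])
  moreover have "s \<in> range (\<lambda>x. a + Q x)" if "s \<in> S" for s
  proof -
    have "s - a \<in> T"
      unfolding T_def using that by (intro span_base) (auto simp: image_iff)
    then obtain z where "s - a = Q z" using Q(2) by blast
    then show ?thesis by (metis add_diff_cancel_left' diff_add_cancel add.commute rangeI)
  qed
  ultimately show ?thesis by (intro exI[of _ "\<lambda>x. a + Q x"]) auto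
qed

text \<open>
  Membership of \<open>f w\<close> in a fixed affine subspace is an affine condition on \<open>w\<close>, so it
  passes from \<open>S\<close> to the affine hull of \<open>S\<close>.
\<close>
lemma affine_range_subset:
  fixes L :: "'a::real_vector \<Rightarrow> 'b::real_vector"
  assumes "linear L" and "affine R" and "affine hull S = UNIV" and "(\<lambda>w. L w + b) ` S \<subseteq> R"
  shows "L w + b \<in> R"
proof -
  interpret L: linear L by fact
  have "affine {w. L w + b \<in> R}"
    unfolding affine_def
  proof (clarify)
    fix x y u v
    assume "L x + b \<in> R" "L y + b \<in> R" and uv: "u + v = (1::real)"
    then have "u *\<^sub>R (L x + b) + v *\<^sub>R (L y + b) \<in> R"
      using \<open>affine R\<close> by (simp add: affine_def)
    also have "u *\<^sub>R (L x + b) + v *\<^sub>R (L y + b) = L (u *\<^sub>R x + v *\<^sub>R y) + (u + v) *\<^sub>R b"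
      by (simp add: L.add L.scaleR algebra_simps)
    finally show "L (u *\<^sub>R x + v *\<^sub>R y) + b \<in> R" using uv by simp
  qed
  then have "affine hull S \<subseteq> {w. L w + b \<in> R}"
    using assms(4) by (intro hull_minimal) auto
  then show ?thesis using assms(3) by auto
qed

text \<open>
  A linear isometry \<open>Q\<close> satisfies \<open>transpose Q ** Q = mat 1\<close> and so cancels from the Gram matrix of
  \<open>Q \<circ> G\<close>. What remains is the Gram matrix of \<open>G\<close>, which is square.
\<close>
lemma det_Gram_isometry_factor:
  fixes G :: "real^'n \<Rightarrow> real^'n" and Q :: "real^'n \<Rightarrow> real^'m"
  assumes "linear G" and "linear Q" and inn: "\<And>x y. Q x \<bullet> Q y = x \<bullet> y"
  shows "det (transpose (matrix (Q \<circ> G)) ** matrix (Q \<circ> G)) = (det (matrix G))\<^sup>2"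
proof -
  have Gram: "transpose (matrix Q) ** matrix Q = mat 1"
    unfolding vec_eq_iff
  proof (intro allI)
    fix i j
    have "(transpose (matrix Q) ** matrix Q) $ i $ j = Q (axis i 1) \<bullet> Q (axis j 1)"
      by (simp add: matrix_matrix_mult_def transpose_def matrix_def inner_vec_def)
    also have "\<dots> = (mat 1 :: real^'n^'n) $ i $ j"
      by (simp add: inn inner_axis_axis mat_def)
    finally show "(transpose (matrix Q) ** matrix Q) $ i $ j = (mat 1 :: real^'n^'n) $ i $ j" .
  qed
  have "transpose (matrix (Q \<circ> G)) ** matrix (Q \<circ> G)
      = transpose (matrix G) ** (transpose (matrix Q) ** matrix Q) ** matrix G"
    by (simp add: matrix_compose[OF assms(1,2)] matrix_transpose_mul matrix_mul_assoc)
  then show ?thesis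
    by (simp add: Gram det_mul det_transpose power2_eq_square)
qed

section \<open>Lebesgue measure of linear images\<close>

text \<open>
  Moving a box moves its linear image by a translation, so boxes with a corner at the origin
  decide. This normalization matters for shears: \<open>measure_shear_interval\<close> wants boxes that lie
  on the nonnegative side in one coordinate.
\<close>
lemma measure_linear_image_if_boxes_at_0:
  fixes h :: "'a::euclidean_space \<Rightarrow> 'a"
  assumes h: "linear h" and S: "S \<in> lmeasurable"
    and box: "\<And>b. cbox 0 b \<noteq> {} \<Longrightarrow> measure lebesgue (h ` cbox 0 b) = measure lebesgue (cbox 0 b)"
  shows "h ` S \<in> lmeasurable" and "measure lebesgue (h ` S) = measure lebesgue S"
proof -
  have "measure lebesgue (h ` cbox a b) = 1 * measure lebesgue (cbox a b)" for a b
  proof (cases "cbox a b = {}")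
    case False
    have ab: "cbox a b = (+) a ` cbox 0 (b - a)"
      using cbox_translation[of a 0 "b - a"] by simp
    moreover have "h ` (+) a ` cbox 0 (b - a) = (+) (h a) ` h ` cbox 0 (b - a)"
      by (simp add: image_image linear_add[OF h])
    moreover have "measure lebesgue (h ` cbox 0 (b - a)) = measure lebesgue (cbox 0 (b - a))"
      using False ab by (intro box) auto
    ultimately show ?thesis
      by (simp only: measure_translation mult_1)
  qed simp
  from measure_linear_sufficient[OF h S this]
  show "h ` S \<in> lmeasurable" and "measure lebesgue (h ` S) = measure lebesgue S"
    by simp_all
qed

text \<open>
  Both sides are multiplicative under composition, so elementary maps suffice. The coordinates
  carry no order, so a shear cannot be read as a triangular matrix; its determinant is computed by
  seeing it as a row operation on the identity matrix.
\<close>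
lemma measure_linear_image_unordered:
  fixes f :: "real^'n \<Rightarrow> real^'n"
  assumes "linear f" and "S \<in> lmeasurable"
  shows "measure lebesgue (f ` S) = \<bar>det (matrix f)\<bar> * measure lebesgue S"
proof -
  define P where "P f \<longleftrightarrow> (\<forall>S \<in> lmeasurable. f ` S \<in> lmeasurable \<and>
      measure lebesgue (f ` S) = \<bar>det (matrix f)\<bar> * measure lebesgue S)" for f :: "real^'n \<Rightarrow> real^'n"
  have unimodular: "P h"
    if "\<bar>det (matrix h)\<bar> = 1" "linear h"
      and "\<And>b. cbox 0 b \<noteq> {} \<Longrightarrow> measure lebesgue (h ` cbox 0 b) = measure lebesgue (cbox 0 b)" for h
    unfolding P_def using measure_linear_image_if_boxes_at_0[OF that(2) _ that(3)] that(1) by simp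
  have "P f"
  proof (rule induct_linear_elementary[OF assms(1)])
    fix f g :: "real^'n \<Rightarrow> real^'n"
    assume "linear f" "linear g" and fg: "P f" "P g"
    then have "det (matrix (f \<circ> g)) = det (matrix f) * det (matrix g)"
      by (simp add: matrix_compose det_mul)
    with fg show "P (f \<circ> g)"
      by (simp add: P_def abs_mult mult.assoc flip: image_image)
  next
    fix f :: "real^'n \<Rightarrow> real^'n" and i
    assume zero: "\<And>x. f x $ i = 0"
    have "row i (matrix f) = 0"
      by (simp add: row_def matrix_def vec_eq_iff zero)
    then have "det (matrix f) = 0"
      by (rule det_zero_row)
    moreover have "negligible (f ` S)" for S
      by (rule negligible_subset[OF negligible_standard_hyperplane_cart[of i]]) (auto simp: zero)
    ultimately show "P f"
      by (simp add: P_def negligible_iff_measure)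
  next
    fix c :: "'n \<Rightarrow> real"
    have "det (matrix (\<lambda>x::real^'n. \<chi> i. c i * x $ i)) = prod c UNIV"
      by (subst det_diagonal) (simp_all add: matrix_def axis_def)
    then show "P (\<lambda>x. \<chi> i. c i * x $ i)"
      by (simp add: P_def measurable_stretch measure_stretch)
  next
    fix m n :: 'n
    define p where "p = Transposition.transpose m n"
    define h where "h = (\<lambda>x::real^'n. \<chi> i. x $ p i)"
    have p: "p permutes UNIV" and pp: "p (p i) = i" for i
      by (simp_all add: p_def permutes_swap_id)
    have "matrix h = (\<chi> i. (mat 1 :: real^'n^'n) $ p i)"
      by (simp add: matrix_def h_def vec_eq_iff mat_def axis_def)
    then have "\<bar>det (matrix h)\<bar> = 1"
      using det_permute_rows[OF p, of "mat 1 :: real^'n^'n"] by (simp add: sign_def)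
    moreover have "linear h"
      by (rule linearI) (simp_all add: h_def vec_eq_iff)
    moreover have "measure lebesgue (h ` cbox 0 b) = measure lebesgue (cbox 0 b)"
      if "cbox 0 b \<noteq> {}" for b
    proof -
      have mem: "h x \<in> cbox 0 (h b) \<longleftrightarrow> x \<in> cbox 0 b" for x b
        unfolding mem_box_cart h_def by (simp, metis pp)
      have "h (h x) = x" for x
        by (simp add: h_def pp vec_eq_iff)
      then have im: "h ` cbox 0 b = cbox 0 (h b)"
        using mem by (metis (no_types, lifting) image_eqI image_subsetI subsetI subset_antisym)
      then have "cbox 0 (h b) \<noteq> {}"
        using that by auto
      then show ?thesis
        using that prod.permute[OF p, of "\<lambda>i. b $ i"]
        by (simp add: im content_cbox_cart) (simp add: h_def o_def)
    qed
    ultimately have "P h" by (rule unimodular)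
    then show "P (\<lambda>x. \<chi> i. x $ Transposition.transpose m n i)"
      by (simp add: h_def p_def)
  next
    fix m n :: 'n
    assume mn: "m \<noteq> n"
    define h where "h = (\<lambda>x::real^'n. \<chi> i. if i = m then x $ m + x $ n else x $ i)"
    let ?I = "mat 1 :: real^'n^'n"
    have "matrix h = (\<chi> k. if k = m then row m ?I + 1 *s row n ?I else row k ?I)"
      by (simp add: matrix_def h_def vec_eq_iff row_def mat_def axis_def)
    then have "\<bar>det (matrix h)\<bar> = 1"
      using det_row_operation[OF mn, of ?I 1] by simp
    moreover have "linear h"
      by (rule linearI) (simp_all add: h_def vec_eq_iff algebra_simps)
    moreover have "measure lebesgue (h ` cbox 0 b) = measure lebesgue (cbox 0 b)"
      if "cbox 0 b \<noteq> {}" for b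
      using measure_shear_interval[OF mn that] by (simp add: h_def)
    ultimately have "P h" by (rule unimodular)
    then show "P (\<lambda>x. \<chi> i. if i = m then x $ m + x $ n else x $ i)"
      by (simp add: h_def)
  qed
  with assms(2) show ?thesis by (simp add: P_def)
qed

section \<open>The area formula for affine maps\<close>

text \<open>
  In the chart \<open>\<phi>\<close> the affine map becomes an affine self-map of \<open>real^'n\<close>, whose linear part
  \<open>G\<close> is \<open>L\<close> followed by the adjoint of the linear part of \<open>\<phi>\<close>. The resulting value does not
  mention \<open>\<phi>\<close>, which makes the volume of the image well defined.
\<close>
lemma measure_isometry_vimage_affine_image:
  fixes \<phi> :: "real^'n \<Rightarrow> real^'m" and L :: "real^'n \<Rightarrow> real^'m"
  assumes iso: "\<And>x y. dist (\<phi> x) (\<phi> y) = dist x y"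
    and L: "linear L" and S: "S \<in> lmeasurable" "affine hull S = UNIV"
    and sub: "(\<lambda>w. L w + b) ` S \<subseteq> range \<phi>"
  shows "measure lebesgue (\<phi> -` (\<lambda>w. L w + b) ` S)
    = sqrt (det (transpose (matrix L) ** matrix L)) * measure lebesgue S"
proof -
  obtain Q c where Q: "linear Q" and inn: "\<And>x y. Q x \<bullet> Q y = x \<bullet> y"
    and \<phi>: "\<phi> = (\<lambda>x. Q x + c)"
    using isometry_affine_form[of \<phi>] iso by blast
  interpret Q: linear Q by fact
  interpret L: linear L by fact
  have "range \<phi> = (+) c ` range Q"
    by (simp add: \<phi> image_image add.commute)
  moreover have "affine (range Q)"
    by (intro subspace_imp_affine linear_subspace_image[OF Q] subspace_UNIV)
  ultimately have "affine (range \<phi>)"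
    using affine_translation[of "range Q" c] by simp
  then have cov: "L w + b \<in> range \<phi>" for w
    using affine_range_subset[OF L _ S(2) sub] by blast
  \<comment> \<open>The adjoint of \<open>Q\<close> is a left inverse of \<open>Q\<close>, so \<open>Q \<circ> adjoint Q\<close> is the identity on the
    range of \<open>Q\<close>.\<close>
  have left_inv: "adjoint Q (Q z) = z" for z
    by (rule vector_eq_ldot[THEN iffD1]) (simp add: adjoint_works[OF Q] inn)
  define G where "G = adjoint Q \<circ> L"
  have G: "linear G"
    unfolding G_def using L Q by (intro linear_compose adjoint_linear)
  have QG: "Q (G w) = L w" for w
  proof -
    from cov[of w] cov[of 0] obtain z z0 where "L w + b = Q z + c" "b = Q z0 + c"
      by (auto simp: \<phi> L.zero)
    then have "L w = Q (z - z0)" by (simp add: Q.diff algebra_simps)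
    then show ?thesis by (simp add: G_def left_inv)
  qed
  have "\<bar>det (matrix G)\<bar> = sqrt (det (transpose (matrix L) ** matrix L))"
    using det_Gram_isometry_factor[OF G Q inn] QG by (simp add: o_def)
  moreover have "\<phi> -` (\<lambda>w. L w + b) ` S = (+) (adjoint Q (b - c)) ` G ` S"
  proof -
    obtain z0 where "b = Q z0 + c"
      using cov[of 0] by (auto simp: \<phi> L.zero)
    then have Qb: "Q (adjoint Q (b - c)) = b - c"
      by (simp add: left_inv)
    have eq: "\<phi> (adjoint Q (b - c) + G w) = L w + b" for w
      by (simp add: \<phi> Q.add Qb QG)
    moreover have "inj \<phi>"
      using iso by (metis dist_eq_0_iff injI)
    ultimately have "\<phi> z = L w + b \<longleftrightarrow> z = adjoint Q (b - c) + G w" for z w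
      by (metis injD)
    then show ?thesis by (auto simp: image_iff)
  qed
  ultimately show ?thesis
    by (simp add: measure_translation measure_linear_image_unordered[OF G S(1)])
qed

theorem flat_volume_affine_image:
  fixes L :: "real^'n \<Rightarrow> real^'m"
  assumes "linear L" and "S \<in> lmeasurable" and "affine hull S = UNIV"
    and "aff_dim ((\<lambda>w. L w + b) ` S) = int CARD('n)"
  shows "flat_volume TYPE('n) ((\<lambda>w. L w + b) ` S)
    = sqrt (det (transpose (matrix L) ** matrix L)) * measure lebesgue S"
  unfolding flat_volume_def
proof (rule the_equality)
  show "\<exists>\<phi> :: real^'n \<Rightarrow> real^'m. (\<forall>x y. dist (\<phi> x) (\<phi> y) = dist x y) \<and>
      (\<lambda>w. L w + b) ` S \<subseteq> range \<phi> \<and>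
      sqrt (det (transpose (matrix L) ** matrix L)) * measure lebesgue S
        = measure lebesgue (\<phi> -` (\<lambda>w. L w + b) ` S)"
    using ex_isometry_covering[OF assms(4)]
      measure_isometry_vimage_affine_image[OF _ assms(1-3), of _ b] by metis
qed (use measure_isometry_vimage_affine_image[OF _ assms(1-3), of _ b] in metis)

section \<open>Simplices\<close>

lemma simplex_with_vertices_eq_hull:
  assumes "simplex_with_vertices d p S"
  shows "S = convex hull (p ` {1..d})"
proof -
  have "(int d - 1) simplex S" and "p ` {1..d} = {v. v extreme_point_of S}"
    using assms by (auto simp: simplex_with_vertices_def bij_betw_def)
  then show ?thesis
    using Krein_Milman_Minkowski[of S] compact_simplex convex_simplex by metis
qed

text \<open>A convex set is negligible only if its interior is empty, that is, if it is flat.\<close>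
lemma measure_full_dim_simplex_pos:
  fixes S :: "'a::euclidean_space set"
  assumes "int DIM('a) simplex S"
  shows "measure lebesgue S > 0"
proof -
  have "affine hull S = UNIV"
    using aff_dim_simplex[OF assms] aff_dim_eq_full by blast
  moreover have "S \<noteq> {}"
    using aff_dim_simplex[OF assms] by auto
  ultimately have "interior S \<noteq> {}"
    using rel_interior_eq_empty[OF convex_simplex[OF assms]] rel_interior_interior by metis
  then have "\<not> negligible S"
    using negligible_convex_interior[OF convex_simplex[OF assms]] by simp
  then show ?thesis
    using lmeasurable_compact[OF compact_simplex[OF assms]]
    by (metis negligible_iff_measure0 measure_nonneg order_le_less)
qed

lemma jacobian_affine:
  fixes L :: "real^'n \<Rightarrow> real^'m"
  assumes "linear L"
  shows "jacobian (\<lambda>w. L w + b) (at y) = matrix L"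
proof -
  have "((\<lambda>w. L w + b) has_derivative L) (at y)"
    using assms by (auto intro!: derivative_eq_intros linear_imp_has_derivative)
  then show ?thesis
    unfolding jacobian_def by (metis frechet_derivative_at)
qed

theorem lemma2p1:
  fixes d :: nat
    and \<xi> :: "nat \<Rightarrow> real^'n" and Khat :: "(real^'n) set"
    and x :: "nat \<Rightarrow> real^'m" and K :: "(real^'m) set"
    and F :: "real^'n \<Rightarrow> real^'m" and y :: "real^'n"
  assumes "d \<ge> 2" and "CARD('n) = d - 1" and "CARD('m) = d"
    and "simplex_with_vertices d \<xi> Khat" and "equilateral d \<xi>"
    and "simplex_with_vertices d x K"
    and "affine_map F" and "\<forall>j\<in>{1..d}. F (\<xi> j) = x j"
  shows "flat_volume TYPE('n) K / measure lebesgue Khat =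
    sqrt (det (transpose (jacobian F (at y)) ** jacobian F (at y)))"
proof -
  obtain L b where L: "linear L" and F: "F = (\<lambda>w. L w + b)"
    using assms(7) by (auto simp: affine_map_def)
  have n: "int d - 1 = int CARD('n)"
    using assms(1,2) by simp
  have Khat: "int CARD('n) simplex Khat" and K: "int CARD('n) simplex K"
    using assms(4,6) by (simp_all add: simplex_with_vertices_def n)
  have "F ` Khat = (+) b ` L ` (convex hull (\<xi> ` {1..d}))"
    by (auto simp: F image_image add.commute simplex_with_vertices_eq_hull[OF assms(4)])
  also have "\<dots> = convex hull ((+) b ` L ` \<xi> ` {1..d})"
    by (simp only: convex_hull_linear_image[OF L] convex_hull_translation)
  also have "(+) b ` L ` \<xi> ` {1..d} = F ` \<xi> ` {1..d}"
    by (simp add: image_image F add.commute)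
  also have "F ` \<xi> ` {1..d} = x ` {1..d}"
    using assms(8) by (auto simp: image_image)
  finally have FK: "F ` Khat = K"
    using simplex_with_vertices_eq_hull[OF assms(6)] by simp
  have "affine hull Khat = UNIV"
    using aff_dim_simplex[OF Khat] aff_dim_eq_full[of Khat] by simp
  moreover have "Khat \<in> lmeasurable"
    using Khat by (intro lmeasurable_compact compact_simplex)
  moreover have "aff_dim (F ` Khat) = int CARD('n)"
    using aff_dim_simplex[OF K] FK by simp
  ultimately have "flat_volume TYPE('n) K
      = sqrt (det (transpose (matrix L) ** matrix L)) * measure lebesgue Khat"
    using flat_volume_affine_image[OF L, of Khat b] FK by (simp add: F)
  moreover have "measure lebesgue Khat > 0"
    using Khat by (intro measure_full_dim_simplex_pos) simp
  ultimately show ?thesis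
    by (simp add: F jacobian_affine[OF L])
qed

end
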